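(* Let $\varepsilon<\frac18$. For every Stochastic Knapsack instance $I$ in which every item $i$ satisfies $\mu_i\ge\varepsilon$, there is $k=O\!\left(\frac1\varepsilon\log\frac1\varepsilon\right)$ such that $\mathrm{ADAPT}(I)/A_k(I)\le 1+\varepsilon$. This holds both for Risky and for Non-Risky Stochastic Knapsack.
   Context: Stochastic Knapsack: an instance consists of $n$ items; item $i$ has a deterministic value $v_i\ge 0$ and a random nonnegative size $S_i$ drawn from a known distribution, independently across items. The knapsack capacity is $1$. A policy inserts items one at a time (each at most once) and may stop at any time; execution ends when the policy stops or at the first overflow (total realized size of inserted items exceeds $1$). In Non-Risky Stochastic Knapsack the policy receives the sum of values of inserted items except that the overflowing item contributes no value; in Risky Stochastic Knapsack an overflow yields total value $0$, otherwise the sum of values of inserted items. An adaptive query is a step at which the policy observes the current total realized size of the inserted items; a policy is $k$-semi-adaptive if it makes at most $k$ adaptive queries. $A_k(I)$ is the maximum expected value over $k$-semi-adaptive policies and $\mathrm{ADAPT}(I)=A_n(I)$ is the optimal fully adaptive expected value. The mean truncated size of item $i$ is $\mu_i=\mathbb{E}[\min(S_i,1)]$. *)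

theory Defs
  imports "HOL-Probability.Probability"
begin

record knapsack =
  num_items :: nat
  item_value :: "nat \<Rightarrow> real"
  size_dist :: "nat \<Rightarrow> real measure"

definition knapsack_instance :: "knapsack \<Rightarrow> bool" where
  "knapsack_instance I \<longleftrightarrow>
     (\<forall>i<num_items I. 0 \<le> item_value I i \<and> prob_space (size_dist I i) \<and>
        sets (size_dist I i) = sets borel \<and> (AE x in size_dist I i. 0 \<le> x))"

definition mean_truncated_size :: "knapsack \<Rightarrow> nat \<Rightarrow> real" where
  "mean_truncated_size I i = (\<integral>x. min x 1 \<partial>size_dist I i)"

text \<open>The joint law of the independent sizes.\<close>

definition size_space :: "knapsack \<Rightarrow> (nat \<Rightarrow> real) measure" where
  "size_space I = PiM {..<num_items I} (size_dist I)"

text \<open>A deterministic policy as a decision tree. A query reveals the current total realized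
  size, and the rest of the tree may depend on it; nesting lets decisions depend on all
  earlier observations.\<close>

datatype policy = Stop | Insert nat policy | Query "real \<Rightarrow> policy"

text \<open>The items inserted, in order, when the realized sizes are \<open>S\<close> and the current total size
  is \<open>t\<close>. An overflowing item is included and is then the last one.\<close>

primrec insertions :: "policy \<Rightarrow> (nat \<Rightarrow> real) \<Rightarrow> real \<Rightarrow> nat list" where
  "insertions Stop S t = []"
| "insertions (Insert i p) S t = i # (if t + S i > 1 then [] else insertions p S (t + S i))"
| "insertions (Query f) S t = insertions (f t) S t"

text \<open>\<open>inserts_once p J\<close>: on every branch, only items of \<open>J\<close> are inserted, each at most once.\<close>

primrec inserts_once :: "policy \<Rightarrow> nat set \<Rightarrow> bool" where
  "inserts_once Stop J \<longleftrightarrow> True"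
| "inserts_once (Insert i p) J \<longleftrightarrow> i \<in> J \<and> inserts_once p (J - {i})"
| "inserts_once (Query f) J \<longleftrightarrow> (\<forall>t. inserts_once (f t) J)"

primrec at_most_queries :: "policy \<Rightarrow> nat \<Rightarrow> bool" where
  "at_most_queries Stop k \<longleftrightarrow> True"
| "at_most_queries (Insert i p) k \<longleftrightarrow> at_most_queries p k"
| "at_most_queries (Query f) k \<longleftrightarrow> 0 < k \<and> (\<forall>t. at_most_queries (f t) (k - 1))"

text \<open>Measurability of the decisions is required so that the payoff is a random variable.\<close>

definition semi_adaptive :: "knapsack \<Rightarrow> nat \<Rightarrow> policy \<Rightarrow> bool" where
  "semi_adaptive I k p \<longleftrightarrow>
     inserts_once p {..<num_items I} \<and> at_most_queries p k \<and>
     (\<lambda>S. insertions p S 0) \<in> measurable (size_space I) (count_space UNIV)"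

datatype variant = Risky | NonRisky

definition payoff :: "variant \<Rightarrow> knapsack \<Rightarrow> policy \<Rightarrow> (nat \<Rightarrow> real) \<Rightarrow> real" where
  "payoff w I p S =
     (let xs = insertions p S 0 in
      if sum_list (map S xs) \<le> 1 then sum_list (map (item_value I) xs)
      else case w of Risky \<Rightarrow> 0 | NonRisky \<Rightarrow> sum_list (map (item_value I) (butlast xs)))"

definition expected_payoff :: "variant \<Rightarrow> knapsack \<Rightarrow> policy \<Rightarrow> real" where
  "expected_payoff w I p = (\<integral>S. payoff w I p S \<partial>size_space I)"

text \<open>For a valid instance, the values below are bounded by the sum of all item values,
  and \<open>Stop\<close> is always admissible, so the supremum is a proper one.\<close>

definition semi_adaptive_opt :: "variant \<Rightarrow> nat \<Rightarrow> knapsack \<Rightarrow> real" where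
  "semi_adaptive_opt w k I = (SUP p \<in> {p. semi_adaptive I k p}. expected_payoff w I p)"

definition adaptive_opt :: "variant \<Rightarrow> knapsack \<Rightarrow> real" where
  "adaptive_opt w I = semi_adaptive_opt w (num_items I) I"

end

theory Submission
  imports Defs
begin

text \<open>Every inserted item has mean truncated size at least \<open>\<epsilon>\<close>, so for every policy the quantity
  ``\<open>2\<close> minus the total size'', set to \<open>0\<close> upon overflow, shrinks in expectation by the factor
  \<open>1 - \<epsilon>/2\<close> per insertion; it is at least \<open>1\<close> as long as the knapsack has not overflowed. Hence a
  policy survives \<open>k\<close> insertions with probability at most \<open>2(1 - \<epsilon>/2)^k\<close>. Conditioned on
  survival, what is collected afterwards is at most \<open>ADAPT\<close>, because the remaining policy can be
  run from the empty knapsack. Stopping an optimal policy after \<open>k = O(1/\<epsilon> log (1/\<epsilon>))\<close>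
  insertions therefore loses at most the fraction \<open>\<epsilon>/(1 + \<epsilon>)\<close> of \<open>ADAPT\<close>, and \<open>k\<close> insertions
  need only \<open>k\<close> queries.\<close>

section \<open>Truncated simulation of a policy\<close>

text \<open>Leading queries have no insertion between them, so they all see the same total
  \<open>t\<close> and can be answered at once. This lets \<open>trunc\<close> spend only one query
  per insertion.\<close>

primrec resolve :: "policy \<Rightarrow> real \<Rightarrow> policy" where
  "resolve Stop t = Stop"
| "resolve (Insert i p) t = Insert i p"
| "resolve (Query f) t = resolve (f t) t"

lemma insertions_resolve: "insertions (resolve p t) S t = insertions p S t"
  by (induction p) auto

lemma resolve_not_Query: "resolve p t \<noteq> Query f"
  by (induction p) auto

lemma inserts_once_resolve: "inserts_once p J \<Longrightarrow> inserts_once (resolve p t) J"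
  by (induction p) auto

text \<open>\<open>trunc m t\<^sub>0 p\<close> starts from the empty knapsack, simulates \<open>p\<close> started at total size \<open>t\<^sub>0\<close>
  for at most \<open>m\<close> insertions, and stops as soon as the simulated run has overflowed.
  Consecutive queries of \<open>p\<close> reveal the same number and are merged.\<close>

primrec trunc :: "nat \<Rightarrow> real \<Rightarrow> policy \<Rightarrow> policy" where
  "trunc 0 t\<^sub>0 p = Stop"
| "trunc (Suc m) t\<^sub>0 p = Query (\<lambda>s. if t\<^sub>0 + s > 1 then Stop else
     (case resolve p (t\<^sub>0 + s) of Insert i q \<Rightarrow> Insert i (trunc m t\<^sub>0 q) | _ \<Rightarrow> Stop))"

lemma at_most_queries_trunc: "at_most_queries (trunc m t\<^sub>0 p) m"
  by (induction m arbitrary: p) (auto split: policy.split)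

lemma inserts_once_mono: "inserts_once p J \<Longrightarrow> J \<subseteq> K \<Longrightarrow> inserts_once p K"
proof (induction p arbitrary: J K)
  case (Insert i p)
  from Insert.prems Insert.IH[of "J - {i}" "K - {i}"] show ?case by auto
next
  case (Query f)
  from Query.prems Query.IH[OF rangeI] show ?case by auto blast
qed auto

lemma inserts_once_trunc: "inserts_once p J \<Longrightarrow> inserts_once (trunc m t\<^sub>0 p) J"
proof (induction m arbitrary: p J)
  case (Suc m)
  have "inserts_once (resolve p (t\<^sub>0 + s)) J" for s
    using Suc.prems by (rule inserts_once_resolve)
  then show ?case
    using Suc.IH by (auto split: policy.split) (metis inserts_once.simps(2))+
qed auto

lemma insertions_trunc_overflowed:
  "t\<^sub>0 + s > 1 \<Longrightarrow> insertions (trunc m t\<^sub>0 p) S s = []"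
  by (cases m) auto

text \<open>The real load \<open>s\<close> lags behind the simulated load
  \<open>t\<^sub>0 + s\<close>, and as \<open>t\<^sub>0\<close> is nonnegative, the knapsack cannot
  overflow before the simulated run does. If only the simulated run overflows, the test in the next
  query, if any, stops \<open>trunc\<close> as well.\<close>

lemma insertions_trunc:
  assumes "0 \<le> t\<^sub>0" "t\<^sub>0 + s \<le> 1"
  shows "insertions (trunc m t\<^sub>0 p) S s = take m (insertions p S (t\<^sub>0 + s))"
  using assms(2)
proof (induction m arbitrary: p s)
  case (Suc m)
  have eq: "insertions p S (t\<^sub>0 + s) = insertions (resolve p (t\<^sub>0 + s)) S (t\<^sub>0 + s)"
    by (simp add: insertions_resolve)
  show ?case
  proof (cases "resolve p (t\<^sub>0 + s)")
    case (Insert i q)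
    have "insertions (trunc m t\<^sub>0 q) S (s + S i) = []" if "t\<^sub>0 + s + S i > 1"
      using that by (intro insertions_trunc_overflowed) (simp add: add.assoc)
    moreover have "s + S i \<le> 1" if "t\<^sub>0 + s + S i \<le> 1"
      using that assms(1) by linarith
    ultimately show ?thesis
      using Suc Insert by (auto simp: eq add.assoc not_less)
  qed (use Suc.prems in \<open>auto simp: eq resolve_not_Query\<close>)
qed auto

text \<open>Serves both to restrict the sizes to \<open>J\<close> and to overwrite the size of an
  item that has already been inserted.\<close>

lemma insertions_cong:
  "inserts_once p J \<Longrightarrow> (\<And>i. i \<in> J \<Longrightarrow> S i = S' i) \<Longrightarrow> insertions p S t = insertions p S' t"
proof (induction p arbitrary: J t)
  case (Insert i p)
  have "insertions p S u = insertions p S' u" for u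
    using Insert.prems by (intro Insert.IH[of "J - {i}"]) auto
  then show ?case using Insert.prems by auto
next
  case (Query f)
  then show ?case using Query.IH[of "f t" J t] by auto
qed auto

lemma insertions_set_distinct:
  "inserts_once p J \<Longrightarrow> set (insertions p S t) \<subseteq> J \<and> distinct (insertions p S t)"
proof (induction p arbitrary: J t)
  case (Insert i p)
  from Insert.prems Insert.IH[of "J - {i}"] show ?case by auto
next
  case (Query f)
  then show ?case using Query.IH[of "f t" J t] by auto
qed auto

lemma length_insertions:
  assumes "inserts_once p J" "J \<subseteq> {..<n}"
  shows "length (insertions p S t) \<le> n"
proof -
  have "set (insertions p S t) \<subseteq> {..<n}" "distinct (insertions p S t)"
    using insertions_set_distinct[OF assms(1), of S t] assms(2) by auto
  then show ?thesis
    by (metis card_lessThan card_mono distinct_card finite_lessThan)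
qed

section \<open>Value collected before and after the first \<open>k\<close> insertions\<close>

text \<open>\<open>payoff\<close> for a run that starts at total size \<open>t\<close>. The list is
  a separate argument because there are only countably many lists, which reduces measurability to
  fixed lists.\<close>

definition list_value :: "variant \<Rightarrow> (nat \<Rightarrow> real) \<Rightarrow> real \<Rightarrow> (nat \<Rightarrow> real) \<Rightarrow> nat list \<Rightarrow> real" where
  "list_value w v t S xs =
     (if t + sum_list (map S xs) \<le> 1 then sum_list (map v xs)
      else case w of Risky \<Rightarrow> 0 | NonRisky \<Rightarrow> sum_list (map v (butlast xs)))"

text \<open>An overflow among the first \<open>k\<close> insertions gives 0, as does a list of at
  most \<open>k\<close> items. What remains after them is valued on its own, by
  \<open>list_value\<close> at the total size reached.\<close>

fun late_value ::
  "nat \<Rightarrow> variant \<Rightarrow> (nat \<Rightarrow> real) \<Rightarrow> real \<Rightarrow> (nat \<Rightarrow> real) \<Rightarrow> nat list \<Rightarrow> real" where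
  "late_value 0 w v t S xs = list_value w v t S xs"
| "late_value (Suc k) w v t S [] = 0"
| "late_value (Suc k) w v t S (i # xs) =
     (if t + S i \<le> 1 then late_value k w v (t + S i) S xs else 0)"

lemma payoff_eq: "payoff w I p S = list_value w (item_value I) 0 S (insertions p S 0)"
  by (simp add: payoff_def list_value_def Let_def)

lemma sum_list_nonneg_on: "(\<And>i. i \<in> set xs \<Longrightarrow> 0 \<le> v i) \<Longrightarrow> 0 \<le> sum_list (map v xs)"
  for v :: "nat \<Rightarrow> real"
  by (induction xs) auto

lemma sum_list_butlast_le:
  fixes v :: "nat \<Rightarrow> real"
  assumes "\<And>i. i \<in> set xs \<Longrightarrow> 0 \<le> v i"
  shows "sum_list (map v (butlast xs)) \<le> sum_list (map v xs)"
  using assms by (cases xs rule: rev_cases) auto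

lemma list_value_nonneg:
  assumes "\<And>i. i \<in> set xs \<Longrightarrow> 0 \<le> v i"
  shows "0 \<le> list_value w v t S xs"
  using assms
  by (auto simp: list_value_def split: variant.split intro!: sum_list_nonneg_on dest: in_set_butlastD)

lemma list_value_le_sum:
  assumes "\<And>i. i \<in> set xs \<Longrightarrow> 0 \<le> v i"
  shows "list_value w v t S xs \<le> sum_list (map v xs)"
  using sum_list_butlast_le[OF assms] sum_list_nonneg_on[OF assms]
  by (auto simp: list_value_def split: variant.split)

lemma list_value_antimono:
  assumes "\<And>i. i \<in> set xs \<Longrightarrow> 0 \<le> v i" "s \<le> t"
  shows "list_value w v t S xs \<le> list_value w v s S xs"
  using sum_list_butlast_le[OF assms(1)] sum_list_nonneg_on[OF assms(1)] assms(2)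
  by (auto simp: list_value_def split: variant.split)

lemma late_value_nonneg:
  "(\<And>i. i \<in> set xs \<Longrightarrow> 0 \<le> v i) \<Longrightarrow> 0 \<le> late_value k w v t S xs"
  by (induction k w v t S xs rule: late_value.induct) (auto intro: list_value_nonneg)

lemma late_value_cong:
  "(\<And>i. i \<in> set xs \<Longrightarrow> S i = S' i) \<Longrightarrow> late_value k w v t S xs = late_value k w v t S' xs"
proof (induction k w v t S xs rule: late_value.induct)
  case (1 w v t S xs)
  then have "map S xs = map S' xs" by auto
  then show ?case by (simp only: late_value.simps list_value_def)
qed auto

text \<open>Sizes are nonnegative only almost surely, so for arbitrary \<open>S\<close> the prefix
  sums need not increase. This property of runs takes the place of monotonicity.\<close>

fun ends_at_overflow :: "real \<Rightarrow> (nat \<Rightarrow> real) \<Rightarrow> nat list \<Rightarrow> bool" where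
  "ends_at_overflow t S [] \<longleftrightarrow> True"
| "ends_at_overflow t S (i # xs) \<longleftrightarrow>
     (t + S i > 1 \<longrightarrow> xs = []) \<and> ends_at_overflow (t + S i) S xs"

lemma ends_at_overflow_insertions: "ends_at_overflow t S (insertions p S t)"
  by (induction p arbitrary: t) auto

text \<open>The first overflow inside a prefix would end the list, and then the full sum would
  exceed the capacity.\<close>

lemma ends_at_overflow_take:
  "ends_at_overflow t S xs \<Longrightarrow> t \<le> 1 \<Longrightarrow> t + sum_list (map S xs) \<le> 1 \<Longrightarrow>
     t + sum_list (map S (take k xs)) \<le> 1"
proof (induction xs arbitrary: t k)
  case (Cons i xs)
  have "t + S i \<le> 1" using Cons.prems by force
  then show ?case using Cons.IH[of "t + S i"] Cons.prems by (cases k) (auto simp: add.assoc)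
qed auto

lemma list_value_Cons:
  assumes "t + S i \<le> 1"
  shows "list_value w v t S (i # xs) =
    (if w = Risky \<and> t + S i + sum_list (map S xs) > 1 then 0
     else v i + list_value w v (t + S i) S xs)"
  using assms by (auto simp: list_value_def add.assoc split: variant.split)

text \<open>If an overflow occurs within the first \<open>k\<close> insertions, the prefix is the
  whole list. Otherwise the values before and after the cut add up, except that in the
  \<open>Risky\<close> variant a later overflow sets the left side to 0 while the prefix keeps its
  value.\<close>

lemma list_value_le_take_plus_late:
  assumes "ends_at_overflow t S xs" "t \<le> 1" "\<And>i. i \<in> set xs \<Longrightarrow> 0 \<le> v i"
  shows "list_value w v t S xs \<le> list_value w v t S (take k xs) + late_value k w v t S xs"
  using assms
proof (induction k arbitrary: t xs)
  case 0
  then show ?case by (simp add: list_value_def)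
next
  case (Suc k)
  show ?case
  proof (cases xs)
    case (Cons i ys)
    show ?thesis
    proof (cases "t + S i \<le> 1")
      case True
      have IH: "list_value w v (t + S i) S ys \<le>
          list_value w v (t + S i) S (take k ys) + late_value k w v (t + S i) S ys"
        using Suc True Cons by auto
      have nonneg: "0 \<le> list_value w v t S (i # take k ys)" "0 \<le> late_value k w v (t + S i) S ys"
        using Suc.prems(3) Cons
        by (auto intro!: list_value_nonneg late_value_nonneg) (metis in_set_takeD)
      have "t + S i + sum_list (map S (take k ys)) \<le> 1" if "t + S i + sum_list (map S ys) \<le> 1"
        using that Suc.prems(1) Cons True by (intro ends_at_overflow_take) auto
      then show ?thesis
        using IH True Cons nonneg by (auto simp: list_value_Cons)
    qed (use Suc.prems Cons in auto)
  qed (simp add: list_value_def)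
qed


section \<open>The law of the sizes\<close>

text \<open>Indices beyond the number of items get a dummy law, so that all factors are probability
  spaces.\<close>

definition item_law :: "knapsack \<Rightarrow> nat \<Rightarrow> real measure" where
  "item_law I i = (if i < num_items I then size_dist I i else return borel 0)"

locale valid_knapsack =
  fixes I :: knapsack
  assumes valid: "knapsack_instance I"
begin

lemma prob_space_item_law: "prob_space (item_law I i)"
  using valid by (auto simp: knapsack_instance_def item_law_def intro: prob_space_return)

lemma sets_item_law [measurable_cong]: "sets (item_law I i) = sets borel"
  using valid by (auto simp: knapsack_instance_def item_law_def)

lemma space_item_law: "space (item_law I i) = UNIV"
  using sets_eq_imp_space_eq[OF sets_item_law] by simp

lemma AE_item_law_nonneg: "i < num_items I \<Longrightarrow> AE x in item_law I i. 0 \<le> x"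
  unfolding item_law_def using valid by (simp only: if_True knapsack_instance_def)

lemma item_value_nonneg: "i < num_items I \<Longrightarrow> 0 \<le> item_value I i"
  using valid by (auto simp: knapsack_instance_def)

lemma size_space_eq: "size_space I = PiM {..<num_items I} (item_law I)"
  unfolding size_space_def by (rule PiM_cong) (auto simp: item_law_def)

sublocale sizes: product_prob_space "item_law I" "{..<num_items I}"
  by (intro product_prob_spaceI prob_space_item_law)

text \<open>For \<open>i\<close> outside \<open>J\<close> the coordinate is constantly
  \<open>undefined\<close> on the extensional product space, so no condition on \<open>i\<close> is
  needed.\<close>

lemma borel_measurable_component: "(\<lambda>S. S i) \<in> borel_measurable (PiM J (item_law I))"
proof (cases "i \<in> J")
  case True
  then have "(\<lambda>S. S i) \<in> measurable (PiM J (item_law I)) (item_law I i)"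
    by (rule measurable_component_singleton)
  then show ?thesis by (simp cong: measurable_cong_sets add: sets_item_law)
next
  case False
  then have "(\<lambda>S. S i) \<in> borel_measurable (PiM J (item_law I)) \<longleftrightarrow>
      (\<lambda>S. undefined :: real) \<in> borel_measurable (PiM J (item_law I))"
    by (intro measurable_cong) (auto simp: space_PiM PiE_def extensional_def)
  then show ?thesis by simp
qed

lemma borel_measurable_sum_list_sizes:
  "(\<lambda>S. sum_list (map S xs)) \<in> borel_measurable (PiM J (item_law I))"
  by (induction xs) (auto intro: borel_measurable_add borel_measurable_component)

lemma borel_measurable_list_value_fixed:
  "(\<lambda>S. list_value w v t S xs) \<in> borel_measurable (PiM J (item_law I))"
proof -
  note [measurable] = borel_measurable_sum_list_sizes
  show ?thesis unfolding list_value_def by measurable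
qed

lemma borel_measurable_late_value_fixed:
  "(\<lambda>S. late_value k w v t S xs) \<in> borel_measurable (PiM J (item_law I))"
proof -
  note [measurable] = borel_measurable_sum_list_sizes
  \<comment> \<open>The recursion adds the random size \<open>S i\<close> to the starting total, so
    the induction carries along the list \<open>ys\<close> of items already passed.\<close>
  have "(\<lambda>S. late_value k w v (t + sum_list (map S ys)) S xs) \<in> borel_measurable (PiM J (item_law I))"
    for ys
  proof (induction k arbitrary: xs ys)
    case 0
    show ?case unfolding list_value_def late_value.simps by measurable
  next
    case (Suc k)
    show ?case
    proof (cases xs)
      case (Cons i zs)
      have [measurable]: "(\<lambda>S. late_value k w v (t + sum_list (map S ys) + S i) S zs)
          \<in> borel_measurable (PiM J (item_law I))"
        using Suc[of "ys @ [i]" zs] by (simp add: add.assoc)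
      note [measurable] = borel_measurable_component[of i J]
      show ?thesis unfolding Cons late_value.simps by measurable
    qed simp
  qed
  from this[of "[]"] show ?thesis by simp
qed

text \<open>The random list \<open>L S\<close> takes values in a countable type, so the result for
  fixed lists suffices.\<close>

lemma borel_measurable_list_value:
  assumes "L \<in> measurable (PiM J (item_law I)) (count_space UNIV)"
  shows "(\<lambda>S. list_value w v t S (L S)) \<in> borel_measurable (PiM J (item_law I))"
  using borel_measurable_list_value_fixed assms by (rule measurable_compose_countable)

lemma borel_measurable_late_value:
  assumes "L \<in> measurable (PiM J (item_law I)) (count_space UNIV)"
  shows "(\<lambda>S. late_value k w v t S (L S)) \<in> borel_measurable (PiM J (item_law I))"
  using borel_measurable_late_value_fixed assms by (rule measurable_compose_countable)

section \<open>Policies and their values\<close>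

lemma inserted_value_nonneg:
  "inserts_once p J \<Longrightarrow> J \<subseteq> {..<num_items I} \<Longrightarrow> i \<in> set (insertions p S t) \<Longrightarrow> 0 \<le> item_value I i"
  using insertions_set_distinct item_value_nonneg by blast

lemma payoff_nonneg: "semi_adaptive I k p \<Longrightarrow> 0 \<le> payoff w I p S"
  unfolding payoff_eq semi_adaptive_def
  by (intro list_value_nonneg) (auto dest: inserted_value_nonneg)

lemma payoff_le:
  assumes "semi_adaptive I k p"
  shows "payoff w I p S \<le> (\<Sum>i<num_items I. item_value I i)"
proof -
  have p: "inserts_once p {..<num_items I}" using assms by (simp add: semi_adaptive_def)
  let ?xs = "insertions p S 0"
  have "payoff w I p S \<le> sum_list (map (item_value I) ?xs)"
    unfolding payoff_eq by (intro list_value_le_sum) (use p inserted_value_nonneg in blast)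
  also have "\<dots> = sum (item_value I) (set ?xs)"
    using insertions_set_distinct[OF p, of S 0] by (simp add: sum_list_distinct_conv_sum_set)
  also have "\<dots> \<le> (\<Sum>i<num_items I. item_value I i)"
    using insertions_set_distinct[OF p, of S 0] item_value_nonneg by (intro sum_mono2) auto
  finally show ?thesis .
qed

lemma borel_measurable_payoff:
  "semi_adaptive I k p \<Longrightarrow> payoff w I p \<in> borel_measurable (size_space I)"
  unfolding payoff_eq[abs_def] semi_adaptive_def size_space_eq
  by (intro borel_measurable_list_value) auto

lemma prob_space_size_space: "prob_space (size_space I)"
  unfolding size_space_eq by (rule sizes.prob_space_axioms)

lemma integrable_payoff:
  assumes "semi_adaptive I k p"
  shows "integrable (size_space I) (payoff w I p)"
proof -
  interpret prob_space "size_space I" by (rule prob_space_size_space)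
  show ?thesis
    using borel_measurable_payoff[OF assms] payoff_nonneg[OF assms] payoff_le[OF assms]
    by (intro integrable_const_bound[where B = "\<Sum>i<num_items I. item_value I i"]) auto
qed

lemma nn_integral_payoff:
  assumes "semi_adaptive I k p"
  shows "(\<integral>\<^sup>+S. ennreal (payoff w I p S) \<partial>size_space I) = ennreal (expected_payoff w I p)"
  unfolding expected_payoff_def
  using integrable_payoff[OF assms] payoff_nonneg[OF assms] by (intro nn_integral_eq_integral) auto

lemma expected_payoff_nonneg: "semi_adaptive I k p \<Longrightarrow> 0 \<le> expected_payoff w I p"
  unfolding expected_payoff_def by (intro integral_nonneg_AE) (auto dest: payoff_nonneg)

lemma expected_payoff_le_opt:
  assumes "semi_adaptive I k p"
  shows "expected_payoff w I p \<le> semi_adaptive_opt w k I"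
proof -
  interpret prob_space "size_space I" by (rule prob_space_size_space)
  have "expected_payoff w I q \<le> (\<Sum>i<num_items I. item_value I i)" if "semi_adaptive I k q" for q
    unfolding expected_payoff_def
    using integrable_payoff[OF that] payoff_le[OF that] by (intro integral_le_const) auto
  then have "bdd_above (expected_payoff w I ` {p. semi_adaptive I k p})"
    by (auto intro!: bdd_aboveI)
  then show ?thesis
    unfolding semi_adaptive_opt_def using assms by (intro cSUP_upper) auto
qed

lemma semi_adaptive_Stop: "semi_adaptive I k Stop"
  by (simp add: semi_adaptive_def)

lemma semi_adaptive_opt_nonneg: "0 \<le> semi_adaptive_opt w k I"
  using expected_payoff_le_opt[OF semi_adaptive_Stop] expected_payoff_nonneg[OF semi_adaptive_Stop]
  by (rule order_trans[rotated])

section \<open>A residual policy is worth at most \<open>ADAPT\<close>\<close>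

text \<open>Simulating \<open>p\<close> from the empty knapsack gives an admissible policy that
  inserts the same items. Its true load is smaller by \<open>t\<close>, so it earns at least as
  much.\<close>

lemma residual_value_le_adaptive_opt:
  assumes p: "inserts_once p J" and J: "J \<subseteq> {..<num_items I}" and t: "0 \<le> t" "t \<le> 1"
    and meas: "(\<lambda>S. insertions p S t) \<in> measurable (PiM J (item_law I)) (count_space UNIV)"
  shows "(\<integral>\<^sup>+S. ennreal (list_value w (item_value I) t S (insertions p S t)) \<partial>PiM J (item_law I))
    \<le> ennreal (adaptive_opt w I)"
proof -
  let ?n = "num_items I" and ?N = "{..<num_items I}" and ?v = "item_value I"
  let ?r = "\<lambda>S. restrict S J"
  define p' where "p' = trunc ?n t p"
  have r [measurable]: "?r \<in> measurable (PiM ?N (item_law I)) (PiM J (item_law I))"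
    using J by (rule measurable_restrict_subset)
  have restr: "insertions p (?r S) t = insertions p S t" for S
    using p by (intro insertions_cong[of p J]) auto
  \<comment> \<open>A run inserts at most \<open>?n\<close> distinct items, so truncation after
    \<open>?n\<close> insertions cuts nothing off.\<close>
  have ins: "insertions p' S 0 = insertions p S t" for S
    using insertions_trunc[of t 0 ?n p S] length_insertions[OF p J] t by (simp add: p'_def)
  have sa: "semi_adaptive I ?n p'"
    unfolding semi_adaptive_def
  proof (intro conjI)
    show "inserts_once p' ?N"
      unfolding p'_def using inserts_once_trunc[OF p] J by (rule inserts_once_mono)
    show "at_most_queries p' ?n" unfolding p'_def by (rule at_most_queries_trunc)
    show "(\<lambda>S. insertions p' S 0) \<in> measurable (size_space I) (count_space UNIV)"
      using measurable_compose[OF r meas] by (simp add: ins restr size_space_eq)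
  qed
  \<comment> \<open>The sizes of the items in \<open>J\<close> are a marginal of the full product
    law, which moves the integral to the space of all sizes.\<close>
  have "PiM J (item_law I) = distr (PiM ?N (item_law I)) (PiM J (item_law I)) ?r"
    using J by (intro sizes.distr_restrict) auto
  then have "(\<integral>\<^sup>+S. ennreal (list_value w ?v t S (insertions p S t)) \<partial>PiM J (item_law I)) =
      (\<integral>\<^sup>+S. ennreal (list_value w ?v t S (insertions p S t))
        \<partial>distr (PiM ?N (item_law I)) (PiM J (item_law I)) ?r)"
    by simp
  also have "\<dots> = (\<integral>\<^sup>+S. ennreal (list_value w ?v t (?r S) (insertions p (?r S) t)) \<partial>PiM ?N (item_law I))"
    using measurable_compose[OF borel_measurable_list_value[OF meas] measurable_ennreal]
    by (intro nn_integral_distr r) simp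
  also have "\<dots> \<le> (\<integral>\<^sup>+S. ennreal (payoff w I p' S) \<partial>size_space I)"
    unfolding size_space_eq
  proof (intro nn_integral_mono ennreal_leI)
    fix S
    let ?xs = "insertions p S t"
    have "set ?xs \<subseteq> J" using insertions_set_distinct[OF p] by blast
    \<comment> \<open>\<open>late_value 0\<close> unfolds to \<open>list_value\<close>, so the
      congruence rule for the former applies.\<close>
    then have "list_value w ?v t (?r S) ?xs = list_value w ?v t S ?xs"
      using late_value_cong[of ?xs "?r S" S 0 w ?v t] by (simp add: subset_eq)
    also have "\<dots> \<le> list_value w ?v 0 S ?xs"
      using inserted_value_nonneg[OF p J] t by (intro list_value_antimono) auto
    finally show "list_value w ?v t (?r S) (insertions p (?r S) t) \<le> payoff w I p' S"
      by (simp add: payoff_eq ins restr)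
  qed
  also have "\<dots> = ennreal (expected_payoff w I p')" by (rule nn_integral_payoff[OF sa])
  also have "\<dots> \<le> ennreal (adaptive_opt w I)"
    unfolding adaptive_opt_def by (intro ennreal_leI expected_payoff_le_opt sa)
  finally show ?thesis .
qed

section \<open>Decay of the late value\<close>

text \<open>Without overflow \<open>x\<close> equals \<open>min x 1\<close>; with overflow the
  potential drops to 0, which is at most \<open>2 - t - min x 1\<close>. In expectation this leaves
  at most \<open>2 - t - \<epsilon>\<close>, and \<open>2 - t\<close> is at most 2, so the loss is
  at least the fraction \<open>\<epsilon> / 2\<close>.\<close>

lemma nn_integral_potential_step:
  assumes i: "i < num_items I" and mu: "\<epsilon> \<le> mean_truncated_size I i" "0 < \<epsilon>"
    and t: "0 \<le> t" "t \<le> 1" and c: "0 \<le> c"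
  shows "(\<integral>\<^sup>+x. (if t + x \<le> 1 then ennreal ((2 - (t + x)) * c) else 0) \<partial>item_law I i)
    \<le> ennreal ((2 - t) * ((1 - \<epsilon> / 2) * c))"
proof -
  have prob: "prob_space (item_law I i)" by (rule prob_space_item_law)
  have nonneg: "AE x in item_law I i. 0 \<le> x" using i by (rule AE_item_law_nonneg)
  have int: "integrable (item_law I i) (\<lambda>x. min x 1)"
    by (rule finite_measure.integrable_const_bound[OF prob_space.finite_measure[OF prob], where B = 1]) (use nonneg in auto)
  have mean: "(\<integral>x. min x 1 \<partial>item_law I i) = mean_truncated_size I i"
    using i by (simp add: mean_truncated_size_def item_law_def)
  have "(\<integral>\<^sup>+x. (if t + x \<le> 1 then ennreal ((2 - (t + x)) * c) else 0) \<partial>item_law I i)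
      \<le> (\<integral>\<^sup>+x. ennreal ((2 - t - min x 1) * c) \<partial>item_law I i)"
  proof (intro nn_integral_mono_AE, use nonneg in eventually_elim)
    fix x :: real assume "0 \<le> x"
    then show "(if t + x \<le> 1 then ennreal ((2 - (t + x)) * c) else 0) \<le> ennreal ((2 - t - min x 1) * c)"
      using t by (auto simp: min_def diff_diff_eq)
  qed
  also have "\<dots> = ennreal (\<integral>x. (2 - t - min x 1) * c \<partial>item_law I i)"
    using int t c by (intro nn_integral_eq_integral) (auto intro!: AE_I2 mult_nonneg_nonneg)
  also have "(\<integral>x. (2 - t - min x 1) * c \<partial>item_law I i) = (2 - t - mean_truncated_size I i) * c"
    using int by (simp add: mean prob_space.prob_space[OF prob])
  also have "\<dots> \<le> ((2 - t) * (1 - \<epsilon> / 2)) * c"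
  proof (intro mult_right_mono c)
    have "t * \<epsilon> \<ge> 0" using t mu by simp
    then show "2 - t - mean_truncated_size I i \<le> (2 - t) * (1 - \<epsilon> / 2)"
      using mu by (simp add: algebra_simps)
  qed
  finally show ?thesis by (simp add: ennreal_leI mult.assoc)
qed

text \<open>Induction on \<open>k\<close>: the first inserted item is integrated out last. The
  hypothesis bounds the rest of the run for each fixed size of that item, and
  \<open>nn_integral_potential_step\<close> averages this bound.\<close>

lemma late_value_bound:
  assumes mu: "\<And>i. i < num_items I \<Longrightarrow> \<epsilon> \<le> mean_truncated_size I i" and eps: "0 < \<epsilon>" "\<epsilon> \<le> 2"
    and "inserts_once p J" "J \<subseteq> {..<num_items I}" "0 \<le> t" "t \<le> 1"
    and "(\<lambda>S. insertions p S t) \<in> measurable (PiM J (item_law I)) (count_space UNIV)"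
  shows "(\<integral>\<^sup>+S. ennreal (late_value k w (item_value I) t S (insertions p S t)) \<partial>PiM J (item_law I))
    \<le> ennreal ((2 - t) * ((1 - \<epsilon> / 2) ^ k * adaptive_opt w I))"
  using assms(4-8)
proof (induction k arbitrary: p J t)
  case 0
  have "(\<integral>\<^sup>+S. ennreal (late_value 0 w (item_value I) t S (insertions p S t)) \<partial>PiM J (item_law I))
      \<le> ennreal (adaptive_opt w I)"
    using residual_value_le_adaptive_opt[OF 0] by simp
  \<comment> \<open>The potential \<open>2 - t\<close> is at least 1 because the knapsack has not
    overflowed.\<close>
  also have "1 * adaptive_opt w I \<le> (2 - t) * adaptive_opt w I"
    using 0 semi_adaptive_opt_nonneg unfolding adaptive_opt_def by (intro mult_right_mono) auto
  then have "ennreal (adaptive_opt w I) \<le> ennreal ((2 - t) * ((1 - \<epsilon> / 2) ^ 0 * adaptive_opt w I))"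
    by (intro ennreal_leI) simp
  finally show ?case .
next
  case (Suc k)
  let ?v = "item_value I"
  let ?c = "(1 - \<epsilon> / 2) ^ k * adaptive_opt w I"
  have c: "0 \<le> ?c"
    using eps semi_adaptive_opt_nonneg unfolding adaptive_opt_def by simp
  have eq: "insertions p S t = insertions (resolve p t) S t" for S
    by (simp add: insertions_resolve)
  have once: "inserts_once (resolve p t) J"
    using Suc.prems(1) by (rule inserts_once_resolve)
  show ?case
  proof (cases "resolve p t")
    case (Insert i q)
    have i: "i \<in> J" "i < num_items I" and q: "inserts_once q (J - {i})"
      using once Insert Suc.prems(2) by auto
    have ins: "insertions p S t = i # (if t + S i > 1 then [] else insertions q S (t + S i))" for S
      by (simp add: eq Insert)
    \<comment> \<open>The rest \<open>q\<close> never inserts \<open>i\<close> again, so its run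
      depends on the size of \<open>i\<close> only through the starting total.\<close>
    have ins_upd: "insertions q (S(i := y)) u = insertions q S u" for S y u
      using q by (intro insertions_cong[of q "J - {i}"]) auto
    have J: "insert i (J - {i}) = J" using i by auto
    have fin: "finite (J - {i})"
      using Suc.prems(2) by (meson finite_Diff finite_lessThan finite_subset)
    have upd: "(\<lambda>S. S(i := y)) \<in> measurable (PiM (J - {i}) (item_law I)) (PiM J (item_law I))" for y
      using J by (intro measurable_fun_upd[where J = "J - {i}"]) (auto simp: space_item_law)
    have step: "(\<integral>\<^sup>+S. ennreal (late_value (Suc k) w ?v t (S(i := y)) (insertions p (S(i := y)) t))
          \<partial>PiM (J - {i}) (item_law I)) \<le> (if t + y \<le> 1 then ennreal ((2 - (t + y)) * ?c) else 0)"
      if y: "0 \<le> y" for y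
    proof (cases "t + y \<le> 1")
      case True
      \<comment> \<open>Freezing coordinate \<open>i\<close> at \<open>y\<close> and dropping the
        head of the list derives the measurability of this run from that of
        \<open>p\<close>.\<close>
      have tl: "insertions q S (t + y) = tl (insertions p (S(i := y)) t)" for S
        using True by (simp add: ins ins_upd)
      have meas: "(\<lambda>S. insertions q S (t + y))
          \<in> measurable (PiM (J - {i}) (item_law I)) (count_space UNIV)"
        unfolding tl by (rule measurable_compose[OF measurable_compose[OF upd Suc.prems(5)]]) simp
      have "late_value k w ?v (t + y) (S(i := y)) (insertions q S (t + y)) =
          late_value k w ?v (t + y) S (insertions q S (t + y))" for S
        using insertions_set_distinct[OF q, of S "t + y"] by (intro late_value_cong) auto
      then show ?thesis
        using Suc.IH[OF q _ _ True meas] True y Suc.prems by (auto simp: ins ins_upd)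
    qed (simp add: ins)
    \<comment> \<open>By independence the size of \<open>i\<close> splits off from the
      product.\<close>
    have "(\<integral>\<^sup>+S. ennreal (late_value (Suc k) w ?v t S (insertions p S t)) \<partial>PiM J (item_law I)) =
        (\<integral>\<^sup>+y. \<integral>\<^sup>+S. ennreal (late_value (Suc k) w ?v t (S(i := y)) (insertions p (S(i := y)) t))
          \<partial>PiM (J - {i}) (item_law I) \<partial>item_law I i)"
      using sizes.product_nn_integral_insert_rev[OF fin, of i
          "\<lambda>S. ennreal (late_value (Suc k) w ?v t S (insertions p S t))"]
        measurable_compose[OF borel_measurable_late_value[OF Suc.prems(5)] measurable_ennreal]
      unfolding J by simp
    also have "\<dots> \<le> (\<integral>\<^sup>+y. (if t + y \<le> 1 then ennreal ((2 - (t + y)) * ?c) else 0) \<partial>item_law I i)"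
      by (rule nn_integral_mono_AE[OF eventually_mono[OF AE_item_law_nonneg[OF i(2)] step]])
    also have "\<dots> \<le> ennreal ((2 - t) * ((1 - \<epsilon> / 2) * ?c))"
      using i(2) mu[OF i(2)] eps(1) Suc.prems(3,4) c by (rule nn_integral_potential_step)
    finally show ?thesis by (simp add: mult.assoc)
  qed (simp_all add: eq resolve_not_Query)
qed

section \<open>Loss caused by stopping after \<open>k\<close> insertions\<close>

text \<open>Each adaptive policy is compared with its truncation \<open>trunc k 0 p\<close>; the
  supremum is taken only at the end. The factor 2 is the potential \<open>2 - t\<close> at
  \<open>t = 0\<close>.\<close>

lemma adaptive_opt_le:
  assumes mu: "\<And>i. i < num_items I \<Longrightarrow> \<epsilon> \<le> mean_truncated_size I i" and eps: "0 < \<epsilon>" "\<epsilon> \<le> 2"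
  shows "adaptive_opt w I \<le> semi_adaptive_opt w k I + 2 * (1 - \<epsilon> / 2) ^ k * adaptive_opt w I"
    (is "_ \<le> ?A + ?D")
proof -
  let ?N = "{..<num_items I}" and ?v = "item_value I"
  have D: "0 \<le> ?D"
    using eps semi_adaptive_opt_nonneg unfolding adaptive_opt_def by simp
  have "expected_payoff w I p \<le> ?A + ?D" if sa: "semi_adaptive I (num_items I) p" for p
  proof -
    have p: "inserts_once p ?N"
      and meas: "(\<lambda>S. insertions p S 0) \<in> measurable (PiM ?N (item_law I)) (count_space UNIV)"
      using sa by (auto simp: semi_adaptive_def size_space_eq)
    define q where "q = trunc k 0 p"
    have ins: "insertions q S 0 = take k (insertions p S 0)" for S
      using insertions_trunc[of 0 0 k p S] by (simp add: q_def)
    have sa_q: "semi_adaptive I k q"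
      unfolding semi_adaptive_def
    proof (intro conjI)
      show "inserts_once q ?N" unfolding q_def using p by (rule inserts_once_trunc)
      show "at_most_queries q k" unfolding q_def by (rule at_most_queries_trunc)
      show "(\<lambda>S. insertions q S 0) \<in> measurable (size_space I) (count_space UNIV)"
        unfolding ins size_space_eq by (rule measurable_compose[OF meas]) simp
    qed
    let ?late = "\<lambda>S. late_value k w ?v 0 S (insertions p S 0)"
    have late_nonneg: "0 \<le> ?late S" for S
      using inserted_value_nonneg[OF p] by (intro late_value_nonneg) auto
    have "ennreal (expected_payoff w I p) = (\<integral>\<^sup>+S. ennreal (payoff w I p S) \<partial>size_space I)"
      by (rule nn_integral_payoff[OF sa, symmetric])
    also have "\<dots> \<le> (\<integral>\<^sup>+S. ennreal (payoff w I q S) + ennreal (?late S) \<partial>size_space I)"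
    proof (intro nn_integral_mono)
      fix S
      have "payoff w I p S \<le> payoff w I q S + ?late S"
        unfolding payoff_eq ins
        using inserted_value_nonneg[OF p]
        by (intro list_value_le_take_plus_late ends_at_overflow_insertions) auto
      then show "ennreal (payoff w I p S) \<le> ennreal (payoff w I q S) + ennreal (?late S)"
        using payoff_nonneg[OF sa_q] late_nonneg by (simp flip: ennreal_plus add: ennreal_leI)
    qed
    also have "\<dots> = (\<integral>\<^sup>+S. ennreal (payoff w I q S) \<partial>size_space I) +
        (\<integral>\<^sup>+S. ennreal (?late S) \<partial>size_space I)"
      using borel_measurable_payoff[OF sa_q] borel_measurable_late_value[OF meas]
      by (intro nn_integral_add) (auto simp: size_space_eq)
    also have "\<dots> \<le> ennreal (expected_payoff w I q) + ennreal ?D"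
      unfolding nn_integral_payoff[OF sa_q]
      using late_value_bound[OF mu eps p _ _ _ meas, of k w]
      by (intro add_left_mono) (simp add: size_space_eq mult.assoc)
    also have "\<dots> = ennreal (expected_payoff w I q + ?D)"
      using expected_payoff_nonneg[OF sa_q] D by simp
    finally have "expected_payoff w I p \<le> expected_payoff w I q + ?D"
      using add_nonneg_nonneg[OF expected_payoff_nonneg[OF sa_q] D] by (simp only: ennreal_le_iff)
    with expected_payoff_le_opt[OF sa_q, of w] show ?thesis by linarith
  qed
  then show ?thesis
    unfolding adaptive_opt_def[of w I] semi_adaptive_opt_def[of w "num_items I"]
    using semi_adaptive_Stop
    by (intro cSUP_least) (auto simp: adaptive_opt_def semi_adaptive_opt_def)
qed

end

section \<open>Choice of \<open>k\<close> and conclusion\<close>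

text \<open>From \<open>1 - x \<le> exp (- x)\<close> at \<open>x = \<epsilon> / 2\<close>, the
  power is at most \<open>\<epsilon> / exp 2\<close>, and \<open>exp 2 \<ge> 4\<close> exceeds
  \<open>2 * (1 + \<epsilon>)\<close>.\<close>

lemma survival_bound:
  fixes \<epsilon> :: real
  assumes eps: "0 < \<epsilon>" "\<epsilon> < 1" and k: "2 / \<epsilon> * (2 + ln (1 / \<epsilon>)) \<le> real k"
  shows "2 * (1 - \<epsilon> / 2) ^ k \<le> \<epsilon> / (1 + \<epsilon>)"
proof -
  have "(1 - \<epsilon> / 2) ^ k \<le> exp (- (\<epsilon> / 2)) ^ k"
    using eps exp_ge_add_one_self[of "- (\<epsilon> / 2)"] by (intro power_mono) auto
  also have "\<dots> = exp (- (\<epsilon> / 2 * real k))"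
    by (simp add: exp_of_nat_mult[symmetric] mult.commute)
  also have "\<epsilon> / 2 * real k \<ge> 2 + ln (1 / \<epsilon>)"
    using k eps by (simp add: field_simps)
  then have "exp (- (\<epsilon> / 2 * real k)) \<le> exp (- 2 - ln (1 / \<epsilon>))" by simp
  also have "\<dots> = \<epsilon> / exp 2"
    using eps by (simp add: exp_diff ln_div exp_minus field_simps)
  also have "\<dots> \<le> \<epsilon> / (2 * (1 + \<epsilon>))"
  proof (intro divide_left_mono)
    have "exp (2::real) = exp 1 * exp 1" by (simp flip: exp_add)
    moreover have "exp (1::real) \<ge> 2" using exp_ge_add_one_self[of 1] by simp
    ultimately have "exp (2::real) \<ge> 2 * 2" by (metis mult_mono' zero_le_numeral)
    then show "2 * (1 + \<epsilon>) \<le> exp 2" using eps by simp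
  qed (use eps in auto)
  finally show ?thesis using eps by (simp add: field_simps)
qed

theorem mainTheorem5:
  "\<exists>C>0. \<forall>(\<epsilon>::real) (I::knapsack) (w::variant).
     0 < \<epsilon> \<longrightarrow> \<epsilon> < 1 / 8 \<longrightarrow> knapsack_instance I \<longrightarrow>
     (\<forall>i<num_items I. \<epsilon> \<le> mean_truncated_size I i) \<longrightarrow>
     (\<exists>k::nat. real k \<le> C * (1 / \<epsilon> * ln (1 / \<epsilon>)) \<and>
        adaptive_opt w I \<le> (1 + \<epsilon>) * semi_adaptive_opt w k I)"
proof (rule exI[of _ 7], intro conjI allI impI)
  fix \<epsilon> :: real and I :: knapsack and w :: variant
  assume eps: "0 < \<epsilon>" "\<epsilon> < 1 / 8" and I: "knapsack_instance I"
    and mu: "\<forall>i<num_items I. \<epsilon> \<le> mean_truncated_size I i"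
  interpret valid_knapsack I using I by unfold_locales
  define L where "L = ln (1 / \<epsilon>)"
  define k where "k = nat \<lceil>2 / \<epsilon> * (2 + L)\<rceil>"
  \<comment> \<open>The upper bound on \<epsilon> makes the logarithm at least 1, so it can absorb
    additive constants.\<close>
  have "8 \<le> 1 / \<epsilon>" using eps by (simp add: field_simps)
  then have "exp 1 \<le> 1 / \<epsilon>" using exp_le by linarith
  then have L: "1 \<le> L"
    unfolding L_def using eps by (subst ln_ge_iff) auto
  have k: "2 / \<epsilon> * (2 + L) \<le> real k" unfolding k_def by linarith
  have "real k \<le> 2 / \<epsilon> * (2 + L) + 1"
  proof -
    have "0 \<le> 2 / \<epsilon> * (2 + L)" using eps L by simp
    then show ?thesis unfolding k_def by linarith
  qed
  \<comment> \<open>The constant 7 is 6 from \<open>2 + L \<le> 3 * L\<close> plus 1 for rounding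
    up.\<close>
  also have "\<dots> \<le> 2 / \<epsilon> * (3 * L) + 1 / \<epsilon> * L"
  proof (intro add_mono mult_left_mono)
    have "1 * 1 \<le> 1 / \<epsilon> * L" using eps L by (intro mult_mono) auto
    then show "1 \<le> 1 / \<epsilon> * L" by simp
  qed (use eps L in auto)
  also have "\<dots> = 7 * (1 / \<epsilon> * L)" using eps by (simp add: field_simps)
  finally have k_le: "real k \<le> 7 * (1 / \<epsilon> * L)" .
  let ?T = "adaptive_opt w I" and ?A = "semi_adaptive_opt w k I"
  have "?T \<le> ?A + 2 * (1 - \<epsilon> / 2) ^ k * ?T"
    using mu eps by (intro adaptive_opt_le) auto
  also have "\<dots> \<le> ?A + \<epsilon> / (1 + \<epsilon>) * ?T"
    using survival_bound[of \<epsilon> k] k eps semi_adaptive_opt_nonneg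
    by (intro add_left_mono mult_right_mono) (auto simp: L_def adaptive_opt_def)
  \<comment> \<open>The retained fraction \<open>1 - \<epsilon> / (1 + \<epsilon>)\<close> equals
    \<open>1 / (1 + \<epsilon>)\<close>.\<close>
  finally have "?T \<le> (1 + \<epsilon>) * ?A" using eps by (simp add: field_simps)
  with k_le show "\<exists>k::nat. real k \<le> 7 * (1 / \<epsilon> * ln (1 / \<epsilon>)) \<and>
      ?T \<le> (1 + \<epsilon>) * semi_adaptive_opt w k I"
    unfolding L_def by blast
qed simp

end
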